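(* Assume $\mathfrak b=\mathfrak d$. Then there exist subspaces $X_0$ and $X_1$ of $2^\omega$ such that $C_p(X_0)$ and $C_p(X_1)$ are $M$-separable, whereas $C_p(X_0)\times C_p(X_1)$ is not $M$-separable.
   Context: $2^\omega$ is the Cantor space. For a space $X$, $C_p(X)$ denotes the space of continuous real-valued functions on $X$ with the topology of pointwise convergence. A topological space $Y$ is $M$-separable if for every sequence $\langle D_n : n\in\omega\rangle$ of dense subsets of $Y$ one can pick finite subsets $F_n\subset D_n$ such that $\bigcup_{n\in\omega}F_n$ is dense in $Y$. For $f,g\in\omega^\omega$, $f\le^* g$ means $f(n)\le g(n)$ for all but finitely many $n$. $\mathfrak b$ is the minimal cardinality of a subset of $\omega^\omega$ unbounded with respect to $\le^*$ (i.e. a set $A$ such that for every $x\in\omega^\omega$ some $a\in A$ satisfies $a\not\le^* x$), and $\mathfrak d$ is the minimal cardinality of a subset $A\subset\omega^\omega$ that is dominating (for every $x\in\omega^\omega$ there is $a\in A$ with $x\le^* a$). *)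

theory Defs
  imports "HOL-Analysis.Analysis" "HOL-Library.Equipollence"
begin

definition le_star :: "(nat \<Rightarrow> nat) \<Rightarrow> (nat \<Rightarrow> nat) \<Rightarrow> bool" where
  "le_star f g \<longleftrightarrow> finite {n. \<not> f n \<le> g n}"

definition unbounded_family :: "(nat \<Rightarrow> nat) set \<Rightarrow> bool" where
  "unbounded_family A \<longleftrightarrow> (\<forall>x. \<exists>a\<in>A. \<not> le_star a x)"

definition dominating_family :: "(nat \<Rightarrow> nat) set \<Rightarrow> bool" where
  "dominating_family A \<longleftrightarrow> (\<forall>x. \<exists>a\<in>A. le_star x a)"

definition b_eq_d :: bool where
  "b_eq_d \<longleftrightarrow> (\<exists>A D. unbounded_family A \<and> (\<forall>A'. unbounded_family A' \<longrightarrow> A \<lesssim> A')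
      \<and> dominating_family D \<and> (\<forall>D'. dominating_family D' \<longrightarrow> D \<lesssim> D')
      \<and> A \<approx> D)"

definition cantor_space :: "(nat \<Rightarrow> bool) topology" where
  "cantor_space = product_topology (\<lambda>_. discrete_topology (UNIV::bool set)) (UNIV::nat set)"

definition Cp :: "'a topology \<Rightarrow> ('a \<Rightarrow> real) topology" where
  "Cp T = subtopology (product_topology (\<lambda>_. euclideanreal) (topspace T))
            {f. continuous_map T euclideanreal f \<and> f \<in> extensional (topspace T)}"

definition dense_in :: "'a topology \<Rightarrow> 'a set \<Rightarrow> bool" where
  "dense_in T D \<longleftrightarrow> D \<subseteq> topspace T \<and> T closure_of D = topspace T"

definition M_separable :: "'a topology \<Rightarrow> bool" where
  "M_separable T \<longleftrightarrow> (\<forall>D :: nat \<Rightarrow> 'a set. (\<forall>n. dense_in T (D n)) \<longrightarrow>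
      (\<exists>F. (\<forall>n. finite (F n) \<and> F n \<subseteq> D n) \<and> dense_in T (\<Union>n. F n)))"

end

theory Submission
  imports Defs
begin

text \<open>
  Since the bounding and the dominating number agree, there is a dominating family of increasing
  functions \<open>g a\<close>, indexed by a well-order whose proper initial segments are too short to index an
  unbounded family, such that \<open>g a\<close> eventually dominates \<open>g b ^^ 3\<close> for all \<open>b < a\<close>. The iterates of
  \<open>g a\<close> at 0 cut the natural numbers into blocks; let \<open>x a\<close> be the union of the odd blocks. The
  spaces consist of all finite sets together with the sets \<open>x a\<close>, respectively with their complements.

  Almost every interval from \<open>n\<close> to \<open>(g a ^^ 3) n\<close> contains a full block of \<open>g a\<close> of the desired
  parity, and this block contains such an interval for any \<open>b < a\<close>. Hence finitely many of the
  \<open>x a\<close> with \<open>a\<close> large have arbitrarily long common gaps, and a clopen neighbourhood of the finitely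
  many subsets of \<open>{..<n}\<close> captures them. The remaining short initial segment of indices is handled
  by boundedness. This yields the selection principle for \<open>\<omega>\<close>-covers which makes the function spaces
  M-separable.

  On the other hand, the pairs of \<open>x a\<close> and its complement form a closed subset of the product of
  the two spaces, and reading off the block boundaries maps it onto a dominating family, so the
  product is not Menger. This is turned into a sequence of dense sets of pairs of functions without
  a dense selection.
\<close>

subsection \<open>Scales\<close>

lemma le_star_iff: "le_star f g \<longleftrightarrow> (\<forall>\<^sub>F n in sequentially. f n \<le> g n)"
  unfolding le_star_def by (simp add: eventually_cofinite flip: cofinite_eq_sequentially)

lemma le_star_le_trans: "le_star f g \<Longrightarrow> (\<And>n. g n \<le> h n) \<Longrightarrow> le_star f h"
  unfolding le_star_iff by (erule eventually_mono) (blast intro: order_trans)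

text \<open>Expresses that the cardinality of \<open>S\<close> is below the bounding number, through
  indexed families, so that bounds chosen along \<open>S\<close> can be merged without cardinal
  arithmetic.\<close>

definition small :: "'i set \<Rightarrow> bool" where
  "small S \<longleftrightarrow> (\<forall>\<phi>::'i \<Rightarrow> nat \<Rightarrow> nat. \<exists>\<psi>. \<forall>b\<in>S. le_star (\<phi> b) \<psi>)"

lemma smallE:
  fixes \<phi> :: "'i \<Rightarrow> nat \<Rightarrow> nat"
  assumes "small S"
  obtains \<psi> where "\<forall>b\<in>S. le_star (\<phi> b) \<psi>"
proof -
  have "\<exists>\<psi>. \<forall>b\<in>S. le_star (\<phi> b) \<psi>" using assms unfolding small_def by (rule spec)
  then show ?thesis using that by auto
qed

lemma small_subset:
  assumes "small S" "T \<subseteq> S" shows "small T"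
  unfolding small_def
proof
  fix \<phi> :: "'a \<Rightarrow> nat \<Rightarrow> nat"
  obtain \<psi> where "\<forall>b\<in>S. le_star (\<phi> b) \<psi>"
    by (rule smallE[OF assms(1), of \<phi>])
  then show "\<exists>\<psi>. \<forall>b\<in>T. le_star (\<phi> b) \<psi>" using assms(2) by (intro exI[of _ \<psi>]) auto
qed

lemma small_insert:
  assumes "small S" shows "small (insert a S)"
  unfolding small_def
proof
  fix \<phi> :: "'a \<Rightarrow> nat \<Rightarrow> nat"
  obtain \<psi> where \<psi>: "\<forall>b\<in>S. le_star (\<phi> b) \<psi>"
    by (rule smallE[OF assms, of \<phi>])
  have "le_star (\<phi> b) (\<lambda>n. max (\<phi> a n) (\<psi> n))" if "b \<in> insert a S" for b
  proof (cases "b = a")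
    case True
    then show ?thesis by (simp add: le_star_def)
  next
    case False
    then show ?thesis using that \<psi> by (intro le_star_le_trans[of "\<phi> b" \<psi> "\<lambda>n. max (\<phi> a n) (\<psi> n)"]) auto
  qed
  then show "\<exists>\<psi>. \<forall>b\<in>insert a S. le_star (\<phi> b) \<psi>" by (intro exI ballI)
qed

lemma small_if_lesspoll_unbounded:
  assumes "\<And>A'. unbounded_family A' \<Longrightarrow> A \<lesssim> A'" and "\<not> A \<lesssim> S"
  shows "small S"
  unfolding small_def
proof
  fix \<phi> :: "'b \<Rightarrow> nat \<Rightarrow> nat"
  have "\<not> unbounded_family (\<phi> ` S)"
    using assms image_lepoll lepoll_trans by blast
  then show "\<exists>\<psi>. \<forall>b\<in>S. le_star (\<phi> b) \<psi>"
    by (auto simp: unbounded_family_def)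
qed

text \<open>\<open>D\<close> is well-ordered in its cardinal type, so no proper initial segment is
  as large as \<open>D\<close>, hence none is as large as the least unbounded family
  \<open>A\<close>, and all of them are \<open>small\<close>. Recursion along \<open>r\<close> can
  therefore put \<open>g a\<close> above a bound of all earlier \<open>g b ^^ 3\<close>.\<close>

lemma scale_exists:
  assumes b_eq_d
  obtains r :: "(nat \<Rightarrow> nat) rel" and g :: "(nat \<Rightarrow> nat) \<Rightarrow> nat \<Rightarrow> nat"
  where "Well_order r" "\<And>a. a \<in> Field r \<Longrightarrow> small (under r a)"
    "\<And>a. strict_mono (g a)" "\<And>a n. n < g a n"
    "\<And>a b. b \<in> underS r a \<Longrightarrow> le_star (g b ^^ 3) (g a)"
    "\<And>h. \<exists>a\<in>Field r. le_star h (g a)"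
proof -
  obtain A D :: "(nat \<Rightarrow> nat) set" where A: "\<And>A'. unbounded_family A' \<Longrightarrow> A \<lesssim> A'"
    and D: "dominating_family D" and AD: "A \<approx> D"
    using assms unfolding b_eq_d_def by blast
  define r where "r = card_of D"
  have wo: "Well_order r" and F: "Field r = D" and co: "Card_order r"
    unfolding r_def by (rule card_of_Well_order Field_card_of card_of_Card_order)+
  have sm: "small (underS r a)" for a
  proof (cases "a \<in> Field r")
    case True
    have "\<not> A \<lesssim> underS r a"
    proof
      assume "A \<lesssim> underS r a"
      then have "D \<lesssim> underS r a"
        using AD eqpoll_imp_lepoll eqpoll_sym lepoll_trans by blast
      then have "(card_of D, card_of (underS r a)) \<in> ordLeq"
        by (auto simp: lepoll_def card_of_ordLeq[symmetric])
      moreover have "(card_of (underS r a), r) \<in> ordLess"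
        using card_of_underS[OF co True] .
      ultimately show False
        using not_ordLess_ordLeq r_def by blast
    qed
    then show ?thesis using A small_if_lesspoll_unbounded by blast
  next
    case False
    then have "underS r a = {}" by (auto simp: underS_def Field_def)
    then show ?thesis by (simp add: small_def)
  qed
  have smu: "small (under r a)" if "a \<in> Field r" for a
  proof -
    have "under r a \<subseteq> insert a (underS r a)" by (auto simp: under_def underS_def)
    then show ?thesis by (rule small_subset[OF small_insert[OF sm]])
  qed
  \<comment> \<open>The index \<open>x\<close> is itself a function. The conjunct
    \<open>le_star x v\<close> makes the resulting \<open>g\<close> inherit domination from
    \<open>D\<close>.\<close>
  define P where "P = (\<lambda>(f::(nat\<Rightarrow>nat)\<Rightarrow>nat\<Rightarrow>nat) x (v::nat\<Rightarrow>nat).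
     strict_mono v \<and> (\<forall>n. n < v n) \<and> le_star x v \<and> (\<forall>b\<in>underS r x. le_star (f b ^^ 3) v))"
  have ex: "\<exists>v. P f x v" for f x
  proof -
    obtain \<psi> where \<psi>: "\<forall>b\<in>underS r x. le_star (f b ^^ 3) \<psi>"
      by (rule smallE[OF sm, of x "\<lambda>b. f b ^^ 3"])
    \<comment> \<open>Partial sums of positive terms: strictly increasing, above the identity, and
      above both \<open>\<psi>\<close> and \<open>x\<close>.\<close>
    define v where "v n = (\<Sum>i\<le>n. \<psi> i + x i + 1)" for n
    have "strict_mono v" by (rule strict_monoI_Suc) (simp add: v_def)
    moreover have "n < v n" for n by (induction n) (auto simp: v_def)
    moreover have "x n \<le> v n" "\<psi> n \<le> v n" for n
      using member_le_sum[of n "{..n}" "\<lambda>i. \<psi> i + x i + 1"] by (auto simp: v_def)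
    moreover from this have "le_star x v" by (simp add: le_star_def)
    moreover have "\<forall>b\<in>underS r x. le_star (f b ^^ 3) v"
      using \<psi> \<open>\<And>n. \<psi> n \<le> v n\<close> by (blast intro: le_star_le_trans[where g = \<psi>])
    ultimately show ?thesis unfolding P_def by blast
  qed
  have "wf (r - Id)" using wo by (simp add: well_order_on_def)
  then have "\<exists>g. \<forall>x. P g x (g x)"
  proof (rule dependent_wf_choice)
    show "P f x v = P f' x v" if "\<And>z. (z, x) \<in> r - Id \<Longrightarrow> f z = f' z" for f f' x v
      using that by (auto simp: P_def underS_def)
  qed (rule ex)
  then obtain g where g: "\<And>x. P g x (g x)" by blast
  show ?thesis
  proof (rule that[of r g])
    show "\<exists>a\<in>Field r. le_star h (g a)" for h
    proof -
      obtain a where "a \<in> D" "le_star h a" using D by (auto simp: dominating_family_def)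
      moreover have "le_star a (g a)" using g[of a] by (simp add: P_def)
      ultimately show ?thesis
        unfolding F le_star_iff by (intro bexI[of _ a]) (auto elim: eventually_elim2)
    qed
  qed (use wo smu g in \<open>auto simp: P_def\<close>)
qed

subsection \<open>Function spaces over subspaces of the Cantor space\<close>

definition pre :: "nat \<Rightarrow> (nat \<Rightarrow> bool) \<Rightarrow> bool list" where
  "pre N x = map x [0..<N]"

lemma pre_eq_iff: "pre N x = pre N y \<longleftrightarrow> (\<forall>i<N. x i = y i)"
  by (auto simp: pre_def)

lemma pre_mono: "pre N x = pre N y \<Longrightarrow> M \<le> N \<Longrightarrow> pre M x = pre M y"
  by (simp add: pre_eq_iff)

lemma topspace_cantor [simp]: "topspace cantor_space = UNIV"
  by (simp add: cantor_space_def)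

lemma openin_cantor_iff:
  "openin cantor_space U \<longleftrightarrow> (\<forall>x\<in>U. \<exists>N. \<forall>y. pre N y = pre N x \<longrightarrow> y \<in> U)" (is "_ \<longleftrightarrow> ?R")
proof
  assume U: "openin cantor_space U"
  show ?R
  proof
    fix x assume "x \<in> U"
    then obtain V where V: "finite {i. V i \<noteq> (UNIV::bool set)}" "x \<in> Pi\<^sub>E UNIV V" "Pi\<^sub>E UNIV V \<subseteq> U"
      using U unfolding cantor_space_def openin_product_topology_alt by fastforce
    obtain N where N: "\<And>i. V i \<noteq> UNIV \<Longrightarrow> i < N"
      using V(1) finite_nat_set_iff_bounded by auto
    have "y \<in> U" if "pre N y = pre N x" for y
    proof -
      have "y i \<in> V i" for i
        using that V(2) N[of i] by (cases "V i = UNIV") (auto simp: pre_eq_iff PiE_iff)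
      then show ?thesis using V(3) by (auto simp: PiE_iff)
    qed
    then show "\<exists>N. \<forall>y. pre N y = pre N x \<longrightarrow> y \<in> U" by blast
  qed
next
  assume R: ?R
  show "openin cantor_space U"
    unfolding cantor_space_def openin_product_topology_alt
  proof (intro conjI ballI)
    fix x assume "x \<in> U"
    then obtain N where N: "\<And>y. pre N y = pre N x \<Longrightarrow> y \<in> U" using R by blast
    have "finite {i. (if i < N then {x i} else UNIV) \<noteq> (UNIV::bool set)}"
      by (rule finite_subset[of _ "{..<N}"]) auto
    moreover have "Pi\<^sub>E UNIV (\<lambda>i. if i < N then {x i} else UNIV) \<subseteq> U"
      using N by (fastforce simp: pre_eq_iff PiE_iff split: if_splits)
    ultimately show "\<exists>V. finite {i\<in>UNIV. V i \<noteq> topspace (discrete_topology UNIV)} \<and>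
        (\<forall>i\<in>UNIV. openin (discrete_topology UNIV) (V i)) \<and> x \<in> Pi\<^sub>E UNIV V \<and> Pi\<^sub>E UNIV V \<subseteq> U"
      by (intro exI[of _ "\<lambda>i. if i < N then {x i} else UNIV"]) (auto simp: PiE_iff)
  qed
qed

lemma eventually_inj_on_pre:
  assumes "finite P"
  shows "\<forall>\<^sub>F N in sequentially. inj_on (pre N) P"
proof -
  have "\<forall>\<^sub>F N in sequentially. p \<noteq> q \<longrightarrow> pre N p \<noteq> pre N q" for p q :: "nat \<Rightarrow> bool"
  proof (cases "p = q")
    case False
    then obtain i where "p i \<noteq> q i" by auto
    then have "\<forall>N\<ge>Suc i. pre N p \<noteq> pre N q" using Suc_le_lessD unfolding pre_eq_iff by blast
    then show ?thesis unfolding eventually_sequentially by blast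
  qed simp
  then have "\<forall>\<^sub>F N in sequentially. \<forall>p\<in>P. \<forall>q\<in>P. p \<noteq> q \<longrightarrow> pre N p \<noteq> pre N q"
    using assms by (simp add: eventually_ball_finite)
  then show ?thesis by (rule eventually_mono) (auto simp: inj_on_def)
qed

lemma topspace_Cp:
  "topspace (Cp T) = {f. continuous_map T euclideanreal f \<and> f \<in> extensional (topspace T)}"
  by (auto simp: Cp_def PiE_def)

lemma openin_Cp_point:
  assumes "p \<in> topspace T" "open V"
  shows "openin (Cp T) {f \<in> topspace (Cp T). f p \<in> V}"
proof -
  have "continuous_map (Cp T) euclideanreal (\<lambda>f. f p)"
    unfolding Cp_def
    by (intro continuous_map_from_subtopology continuous_map_product_projection assms)
  then show ?thesis
    using assms(2) by (simp add: continuous_map_def)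
qed

lemma Cp_nhd:
  assumes "openin (Cp T) U" "g \<in> U"
  obtains P \<epsilon> where "finite P" "P \<subseteq> topspace T" "\<epsilon> > 0"
    "\<And>f. f \<in> topspace (Cp T) \<Longrightarrow> \<forall>p\<in>P. \<bar>f p - g p\<bar> < \<epsilon> \<Longrightarrow> f \<in> U"
proof -
  obtain W where W: "openin (product_topology (\<lambda>_. euclideanreal) (topspace T)) W"
    and U: "U = W \<inter> {f. continuous_map T euclideanreal f \<and> f \<in> extensional (topspace T)}"
    using assms(1) unfolding Cp_def openin_subtopology by auto
  obtain V where V: "finite {i\<in>topspace T. V i \<noteq> (UNIV::real set)}" "\<And>i. i \<in> topspace T \<Longrightarrow> open (V i)"
    "g \<in> Pi\<^sub>E (topspace T) V" "Pi\<^sub>E (topspace T) V \<subseteq> W"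
    using W assms(2) U unfolding openin_product_topology_alt by force
  define P where "P = {i\<in>topspace T. V i \<noteq> UNIV}"
  have "\<forall>p\<in>P. \<exists>e>0. \<forall>t. \<bar>t - g p\<bar> < e \<longrightarrow> t \<in> V p"
  proof
    fix p assume "p \<in> P"
    then have "open (V p)" "g p \<in> V p" using V(2,3) by (auto simp: P_def PiE_iff)
    then show "\<exists>e>0. \<forall>t. \<bar>t - g p\<bar> < e \<longrightarrow> t \<in> V p"
      by (simp add: open_dist dist_real_def)
  qed
  then obtain e where e: "\<And>p. p \<in> P \<Longrightarrow> e p > 0" "\<And>p t. p \<in> P \<Longrightarrow> \<bar>t - g p\<bar> < e p \<Longrightarrow> t \<in> V p"
    by metis
  have fP: "finite P" using V(1) by (simp add: P_def)
  show ?thesis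
  \<comment> \<open>The inserted 1 keeps the minimum meaningful when \<open>P\<close> is
    empty.\<close>
  proof (rule that[of P "Min (insert 1 (e ` P))"])
    show "f \<in> U" if f: "f \<in> topspace (Cp T)" "\<forall>p\<in>P. \<bar>f p - g p\<bar> < Min (insert 1 (e ` P))" for f
    proof -
      have "f i \<in> V i" if "i \<in> topspace T" for i
      proof (cases "i \<in> P")
        case True
        then show ?thesis using f(2) fP e(2) by (auto simp: Min_gr_iff)
      qed (use that in \<open>auto simp: P_def\<close>)
      then have "f \<in> Pi\<^sub>E (topspace T) V" using f(1) by (auto simp: topspace_Cp PiE_iff)
      then show ?thesis using V(4) f(1) by (auto simp: U topspace_Cp)
    qed
  qed (use fP e(1) in \<open>auto simp: P_def\<close>)
qed

lemma dense_in_iff: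
  "dense_in T D \<longleftrightarrow> D \<subseteq> topspace T \<and> (\<forall>x U. openin T U \<and> x \<in> U \<longrightarrow> (\<exists>d\<in>D. d \<in> U))"
proof -
  have "T closure_of D = topspace T \<longleftrightarrow> (\<forall>x U. openin T U \<and> x \<in> U \<longrightarrow> (\<exists>d\<in>D. d \<in> U))"
    unfolding set_eq_iff in_closure_of using openin_subset by blast
  then show ?thesis by (simp add: dense_in_def)
qed

lemma dense_in_CpI:
  assumes "D \<subseteq> topspace (Cp T)"
    "\<And>g P \<epsilon>. g \<in> topspace (Cp T) \<Longrightarrow> finite P \<Longrightarrow> P \<subseteq> topspace T \<Longrightarrow> \<epsilon> > 0 \<Longrightarrow>
      \<exists>f\<in>D. \<forall>p\<in>P. \<bar>f p - g p\<bar> < \<epsilon>"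
  shows "dense_in (Cp T) D"
  unfolding dense_in_iff
proof (intro conjI allI impI)
  fix g U assume gU: "openin (Cp T) U \<and> g \<in> U"
  then have "openin (Cp T) U" "g \<in> U" by auto
  then obtain P \<epsilon> where P: "finite P" "P \<subseteq> topspace T" "\<epsilon> > 0"
    "\<And>f. f \<in> topspace (Cp T) \<Longrightarrow> \<forall>p\<in>P. \<bar>f p - g p\<bar> < \<epsilon> \<Longrightarrow> f \<in> U"
    by (rule Cp_nhd) (rule that)
  have "g \<in> topspace (Cp T)" using gU openin_subset by blast
  then obtain f where "f \<in> D" "\<forall>p\<in>P. \<bar>f p - g p\<bar> < \<epsilon>"
    using assms(2)[OF _ P(1-3)] by blast
  then show "\<exists>d\<in>D. d \<in> U" using assms(1) P(4)[of f] by blast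
qed (rule assms(1))

lemma dense_in_CpD:
  assumes "dense_in (Cp T) D" "g \<in> topspace (Cp T)" "finite P" "P \<subseteq> topspace T" "\<epsilon> > 0"
  shows "\<exists>f\<in>D. \<forall>p\<in>P. \<bar>f p - g p\<bar> < \<epsilon>"
proof -
  define U where "U = (\<Inter>p\<in>P. {f \<in> topspace (Cp T). f p \<in> ball (g p) \<epsilon>}) \<inter> topspace (Cp T)"
  have "openin (Cp T) U"
  proof (cases "P = {}")
    case False
    then show ?thesis unfolding U_def using assms(3,4)
      by (intro openin_Int openin_INT2 openin_Cp_point) auto
  qed (simp add: U_def)
  moreover have "g \<in> U" using assms by (auto simp: U_def)
  ultimately obtain f where "f \<in> D" "f \<in> U" using assms(1) unfolding dense_in_iff by blast
  then show ?thesis by (auto simp: U_def dist_real_def abs_minus_commute intro!: bexI[of _ f])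
qed

lemma prefix_function_in_Cp:
  "restrict (\<lambda>x. h (pre N x)) X \<in> topspace (Cp (subtopology cantor_space X))"
proof -
  have "continuous_map cantor_space euclideanreal (\<lambda>x. h (pre N x))"
    unfolding continuous_map_def openin_cantor_iff by (auto intro!: exI[of _ N])
  then have "continuous_map (subtopology cantor_space X) euclideanreal (\<lambda>x. h (pre N x))"
    by (rule continuous_map_from_subtopology)
  then have "continuous_map (subtopology cantor_space X) euclideanreal (restrict (\<lambda>x. h (pre N x)) X)"
    by (rule continuous_map_eq) auto
  then show ?thesis by (simp add: topspace_Cp)
qed

lemma const_in_Cp: "restrict (\<lambda>x. c) X \<in> topspace (Cp (subtopology cantor_space X))"
  using prefix_function_in_Cp[of "\<lambda>_. c"] .

definition clopen_of :: "nat \<times> bool list list \<Rightarrow> (nat \<Rightarrow> bool) set" where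
  "clopen_of c = {x. pre (fst c) x \<in> set (snd c)}"

text \<open>Codes for locally constant functions with rational values, a countable family that is
  dense in the function spaces. Unlisted prefixes get the value 0.\<close>

definition step_fun :: "nat \<times> (bool list \<times> rat) list \<Rightarrow> (nat \<Rightarrow> bool) \<Rightarrow> real" where
  "step_fun c x = (case map_of (snd c) (pre (fst c) x) of None \<Rightarrow> 0 | Some q \<Rightarrow> of_rat q)"

lemma step_fun_in_Cp: "restrict (step_fun c) X \<in> topspace (Cp (subtopology cantor_space X))"
  unfolding step_fun_def[abs_def] by (rule prefix_function_in_Cp)

text \<open>Prefixes long enough to separate the points of \<open>P\<close> allow a rational
  approximation of \<open>g\<close> to be prescribed at each point independently.\<close>

lemma step_fun_approx:
  assumes "finite P" "\<epsilon> > 0"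
  obtains c where "\<forall>p\<in>P. \<bar>step_fun c p - g p\<bar> < \<epsilon>"
proof -
  have "\<exists>q. \<bar>of_rat q - g p\<bar> < \<epsilon>" for p
  proof -
    obtain q where "of_rat q \<in> {g p - \<epsilon> <..< g p + \<epsilon>}"
      using of_rat_dense[of "g p - \<epsilon>" "g p + \<epsilon>"] assms(2) by auto
    then show ?thesis by (intro exI[of _ q]) (auto simp: abs_less_iff)
  qed
  then obtain q where q: "\<And>p. \<bar>of_rat (q p) - g p\<bar> < \<epsilon>" by metis
  obtain N where N: "inj_on (pre N) P"
    using eventually_inj_on_pre[OF assms(1)] by (auto dest: eventually_happens)
  obtain ps where ps: "set ps = P" "distinct ps" using assms(1) finite_distinct_list by blast
  define L where "L = map (\<lambda>p. (pre N p, q p)) ps"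
  have "distinct (map fst L)"
    using N ps by (simp add: L_def o_def distinct_map)
  then have "map_of L (pre N p) = Some (q p)" if "p \<in> P" for p
    using that ps by (auto simp: L_def intro!: map_of_is_SomeI)
  then show ?thesis using q by (intro that[of "(N, L)"]) (auto simp: step_fun_def)
qed

subsection \<open>A selection principle for clopen covers\<close>

text \<open>The hypothesis on \<open>I\<close> says that every \<open>I n\<close> codes a clopen
  \<omega>-cover of \<open>X\<close>. A finite selection is encoded by the bound
  \<open>\<phi> n\<close> on codes, so that selections can be compared by \<open>le_star\<close>;
  asking for infinitely many \<open>n\<close> makes the condition insensitive to finite changes of
  \<open>\<phi>\<close>.\<close>

definition selects :: "(nat \<Rightarrow> bool) set \<Rightarrow> bool" where
  "selects X \<longleftrightarrow> (\<forall>I. (\<forall>n P. finite P \<and> P \<subseteq> X \<longrightarrow> (\<exists>c\<in>I n. P \<subseteq> clopen_of c)) \<longrightarrow>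
     (\<exists>\<phi>::nat \<Rightarrow> nat. \<forall>P. finite P \<and> P \<subseteq> X \<longrightarrow>
        (\<exists>\<^sub>F n in sequentially. \<exists>c\<in>I n. to_nat c \<le> \<phi> n \<and> P \<subseteq> clopen_of c)))"

lemma finite_to_nat_le: "finite {c :: 'a::countable. to_nat c \<le> m}"
proof (rule finite_imageD)
  show "finite (to_nat ` {c :: 'a. to_nat c \<le> m})" by (rule finite_subset[of _ "{..m}"]) auto
qed (meson inj_on_subset inj_to_nat subset_UNIV)

text \<open>Each point of \<open>P\<close> has a prefix that forces membership in an open set
  inducing \<open>U\<close>; finitely many such prefixes can be extended to a common length.\<close>

lemma clopen_between:
  assumes "finite P" "P \<subseteq> X" "openin (subtopology cantor_space X) U" "P \<subseteq> U"
  obtains c where "P \<subseteq> clopen_of c" "X \<inter> clopen_of c \<subseteq> U"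
proof -
  obtain V where V: "openin cantor_space V" "U = V \<inter> X"
    using assms(3) by (auto simp: openin_subtopology)
  have "\<forall>\<^sub>F N in sequentially. \<forall>y. pre N y = pre N p \<longrightarrow> y \<in> V" if "p \<in> P" for p
  proof -
    have "p \<in> V" using that assms(4) V(2) by auto
    then obtain M where "\<forall>y. pre M y = pre M p \<longrightarrow> y \<in> V"
      using V(1) unfolding openin_cantor_iff by blast
    then have "\<forall>N\<ge>M. \<forall>y. pre N y = pre N p \<longrightarrow> y \<in> V" using pre_mono by blast
    then show ?thesis unfolding eventually_sequentially by blast
  qed
  then have "\<forall>\<^sub>F N in sequentially. \<forall>p\<in>P. \<forall>y. pre N y = pre N p \<longrightarrow> y \<in> V"
    using assms(1) by (simp add: eventually_ball_finite)
  then obtain N where N: "\<And>p y. p \<in> P \<Longrightarrow> pre N y = pre N p \<Longrightarrow> y \<in> V"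
    unfolding eventually_sequentially by blast
  obtain L where L: "set L = pre N ` P" using assms(1) finite_list[of "pre N ` P"] by auto
  show ?thesis
    by (rule that[of "(N, L)"]) (use N L V(2) in \<open>auto simp: clopen_of_def\<close>)
qed

text \<open>For a fixed step function and precision, the clopen sets on which some member of
  \<open>D n\<close> is that close to the step function form an \<omega>-cover, by density of
  \<open>D n\<close> and continuity. Selecting from these covers, for the countably many choices of
  step function and precision, yields the finite sets.\<close>

lemma selects_imp_M_separable:
  assumes "selects X"
  shows "M_separable (Cp (subtopology cantor_space X))" (is "M_separable (Cp ?T)")
  unfolding M_separable_def
proof (intro allI impI)
  fix D :: "nat \<Rightarrow> ((nat \<Rightarrow> bool) \<Rightarrow> real) set"
  assume D: "\<forall>n. dense_in (Cp ?T) (D n)"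
  \<comment> \<open>The number \<open>p\<close> codes a pair of a step function and a natural number
    that determines the precision.\<close>
  define e where "e p = step_fun (fst (from_nat p :: _ \<times> nat))" for p
  define \<epsilon> where "\<epsilon> p = inverse (real (Suc (snd (from_nat p :: (nat \<times> (bool list \<times> rat) list) \<times> nat))))" for p
  have \<epsilon>: "\<epsilon> p > 0" for p by (simp add: \<epsilon>_def)
  define close where "close p c f \<longleftrightarrow> (\<forall>x\<in>X \<inter> clopen_of c. \<bar>f x - e p x\<bar> < \<epsilon> p)" for p c f
  define I where "I p n = {c. \<exists>f\<in>D n. close p c f}" for p n
  have "\<exists>c\<in>I p n. P \<subseteq> clopen_of c" if P: "finite P" "P \<subseteq> X" for p n P
  proof -
    have eC: "restrict (e p) X \<in> topspace (Cp ?T)"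
      unfolding e_def by (rule step_fun_in_Cp)
    have "dense_in (Cp ?T) (D n)" using D by blast
    from dense_in_CpD[OF this eC P(1) _ \<epsilon>[of p]]
    obtain f where f: "f \<in> D n" "\<forall>x\<in>P. \<bar>f x - restrict (e p) X x\<bar> < \<epsilon> p"
      using P(2) by auto
    have fC: "f \<in> topspace (Cp ?T)" using D f(1) by (auto simp: dense_in_def)
    have "continuous_map ?T euclideanreal (\<lambda>x. f x - restrict (e p) X x)"
      using fC eC by (intro continuous_map_diff) (simp_all only: topspace_Cp mem_Collect_eq)
    then have "openin ?T {x\<in>topspace ?T. f x - restrict (e p) X x \<in> {-\<epsilon> p<..<\<epsilon> p}}"
      by (rule openin_continuous_map_preimage) simp
    moreover have "P \<subseteq> {x\<in>topspace ?T. f x - restrict (e p) X x \<in> {-\<epsilon> p<..<\<epsilon> p}}"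
      using f(2) P(2) by (force simp: abs_less_iff)
    ultimately obtain c where c: "P \<subseteq> clopen_of c"
      "X \<inter> clopen_of c \<subseteq> {x\<in>topspace ?T. f x - restrict (e p) X x \<in> {-\<epsilon> p<..<\<epsilon> p}}"
      by (rule clopen_between[OF P])
    have "close p c f" unfolding close_def
    proof
      fix x assume "x \<in> X \<inter> clopen_of c"
      then show "\<bar>f x - e p x\<bar> < \<epsilon> p" using c(2) by (auto simp: abs_less_iff)
    qed
    then show ?thesis using c(1) f(1) unfolding I_def by blast
  qed
  then have "\<exists>\<phi>::nat \<Rightarrow> nat. \<forall>P. finite P \<and> P \<subseteq> X \<longrightarrow>
     (\<exists>\<^sub>F n in sequentially. \<exists>c\<in>I p n. to_nat c \<le> \<phi> n \<and> P \<subseteq> clopen_of c)" for p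
    using assms[unfolded selects_def, THEN spec, of "I p"] by blast
  then have "\<forall>p. \<exists>\<phi>::nat \<Rightarrow> nat. \<forall>P. finite P \<and> P \<subseteq> X \<longrightarrow>
     (\<exists>\<^sub>F n in sequentially. \<exists>c\<in>I p n. to_nat c \<le> \<phi> n \<and> P \<subseteq> clopen_of c)" ..
  from choice[OF this] obtain \<phi> :: "nat \<Rightarrow> nat \<Rightarrow> nat" where \<phi>: "\<And>p P. finite P \<Longrightarrow> P \<subseteq> X \<Longrightarrow>
     (\<exists>\<^sub>F n in sequentially. \<exists>c\<in>I p n. to_nat c \<le> \<phi> p n \<and> P \<subseteq> clopen_of c)"
    by auto
  have "\<forall>p n c. \<exists>f. c \<in> I p n \<longrightarrow> f \<in> D n \<and> close p c f" by (auto simp: I_def)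
  then obtain ch where ch: "\<And>p n c. c \<in> I p n \<Longrightarrow> ch p n c \<in> D n \<and> close p c (ch p n c)"
    by metis
  \<comment> \<open>The restriction to \<open>p \<le> n\<close> keeps \<open>F n\<close> finite.
    Nothing is lost, since the selection for \<open>p\<close> succeeds at infinitely many
    \<open>n\<close>.\<close>
  define F where "F n = (\<Union>p\<le>n. ch p n ` {c\<in>I p n. to_nat c \<le> \<phi> p n})" for n
  have "finite (F n)" for n
    unfolding F_def by (auto intro: finite_subset[OF _ finite_to_nat_le])
  moreover have FD: "F n \<subseteq> D n" for n using ch by (auto simp: F_def)
  moreover have "dense_in (Cp ?T) (\<Union>n. F n)"
  proof (rule dense_in_CpI)
    have "D n \<subseteq> topspace (Cp ?T)" for n using D by (simp add: dense_in_def)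
    then show "(\<Union>n. F n) \<subseteq> topspace (Cp ?T)" using FD by blast
    fix g P and \<delta> :: real
    assume g: "finite P" "P \<subseteq> topspace ?T" "\<delta> > 0"
    then have PX: "P \<subseteq> X" by simp
    obtain s where s: "\<forall>x\<in>P. \<bar>step_fun s x - g x\<bar> < \<delta> / 2"
      using step_fun_approx[OF g(1)] g(3) by (metis half_gt_zero)
    obtain m where m: "inverse (real (Suc m)) < \<delta> / 2"
      using reals_Archimedean[of "\<delta> / 2"] g(3) by auto
    define p where "p = to_nat (s, m)"
    have p: "e p = step_fun s" "\<epsilon> p < \<delta> / 2" using m by (simp_all add: p_def e_def \<epsilon>_def)
    have "\<exists>\<^sub>F n in sequentially. (\<exists>c\<in>I p n. to_nat c \<le> \<phi> p n \<and> P \<subseteq> clopen_of c) \<and> p \<le> n"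
      by (rule frequently_eventually_frequently[OF \<phi>[OF g(1) PX] eventually_ge_at_top])
    then obtain n c where n: "p \<le> n" and c: "c \<in> I p n" "to_nat c \<le> \<phi> p n" "P \<subseteq> clopen_of c"
      by (auto dest: frequently_ex)
    have "ch p n c \<in> (\<Union>n. F n)" using n c by (auto simp: F_def)
    moreover have "\<bar>ch p n c x - g x\<bar> < \<delta>" if "x \<in> P" for x
    proof -
      have "\<bar>ch p n c x - e p x\<bar> < \<epsilon> p"
        using ch[OF c(1)] that PX c(3) by (auto simp: close_def)
      moreover have "\<bar>e p x - g x\<bar> < \<delta> / 2" using s that p(1) by simp
      ultimately show ?thesis using p(2) by linarith
    qed
    ultimately show "\<exists>f\<in>\<Union>n. F n. \<forall>x\<in>P. \<bar>f x - g x\<bar> < \<delta>" by blast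
  qed
  ultimately show "\<exists>F. (\<forall>n. finite (F n) \<and> F n \<subseteq> D n) \<and> dense_in (Cp ?T) (\<Union>n. F n)"
    by blast
qed

text \<open>In the diagonal sum, the term of index \<open>k\<close> is present at every argument
  from \<open>k\<close> on.\<close>

lemma countable_bounded:
  fixes \<phi> :: "nat \<Rightarrow> nat \<Rightarrow> nat"
  shows "\<exists>\<psi>. \<forall>k. le_star (\<phi> k) \<psi>"
proof (intro exI allI)
  fix k
  have "\<phi> k n \<le> (\<Sum>j\<le>n. \<phi> j n)" if "k \<le> n" for n
    using member_le_sum[of k "{..n}" "\<lambda>j. \<phi> j n"] that by simp
  then show "le_star (\<phi> k) (\<lambda>n. \<Sum>j\<le>n. \<phi> j n)"
    unfolding le_star_iff eventually_sequentially by blast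
qed

section \<open>Finite sets and the selection principle from common gaps\<close>

abbreviation "fin_supp \<equiv> {x :: nat \<Rightarrow> bool. finite {n. x n}}"

definition fin_below :: "nat \<Rightarrow> (nat \<Rightarrow> bool) set" where
  "fin_below n = {x. \<forall>i. x i \<longrightarrow> i < n}"

lemma finite_fin_below: "finite (fin_below n)"
proof -
  have "fin_below n \<subseteq> (\<lambda>A i. i \<in> A) ` Pow {..<n}"
  proof
    fix x assume "x \<in> fin_below n"
    then show "x \<in> (\<lambda>A i. i \<in> A) ` Pow {..<n}"
      by (intro image_eqI[of _ _ "{i. x i}"]) (auto simp: fin_below_def)
  qed
  then show ?thesis by (rule finite_subset) simp
qed

lemma fin_below_subset: "fin_below n \<subseteq> fin_supp"
  by (auto simp: fin_below_def intro: finite_subset[of _ "{..<n}"])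

lemma eventually_fin_below:
  assumes "finite E" "E \<subseteq> fin_supp"
  shows "\<forall>\<^sub>F n in sequentially. E \<subseteq> fin_below n"
proof -
  have "\<forall>\<^sub>F n in sequentially. x \<in> fin_below n" if "x \<in> E" for x
  proof -
    have "finite {i. x i}" using that assms(2) by auto
    then obtain m where "\<forall>i. x i \<longrightarrow> i < m" using finite_nat_set_iff_bounded by auto
    then have "\<forall>n\<ge>m. x \<in> fin_below n" by (auto simp: fin_below_def intro: less_le_trans)
    then show ?thesis unfolding eventually_sequentially by blast
  qed
  then have "\<forall>\<^sub>F n in sequentially. \<forall>x\<in>E. x \<in> fin_below n"
    using assms(1) by (simp add: eventually_ball_finite)
  then show ?thesis by (simp add: subset_eq)
qed

text \<open>Choose codes \<open>c n\<close> in \<open>I n\<close> covering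
  \<open>fin_below n\<close>. If finitely many \<open>y b\<close> vanish from \<open>n\<close> up to
  the prefix length of \<open>c n\<close>, that clopen set cannot tell them from members of
  \<open>fin_below n\<close> and contains them too. The indices in the exceptional set
  \<open>S\<close> are treated by induction on the number of points outside \<open>fin_supp\<close>,
  the bounds being merged because \<open>S\<close> is small.\<close>

lemma selects_gap:
  fixes y :: "'i \<Rightarrow> nat \<Rightarrow> bool"
  assumes gap: "\<And>h :: nat \<Rightarrow> nat. \<exists>S\<subseteq>J. small S \<and>
      (\<forall>F. finite F \<and> F \<subseteq> J - S \<longrightarrow>
        (\<exists>\<^sub>F n in sequentially. \<forall>b\<in>F. \<forall>i. n \<le> i \<and> i < h n \<longrightarrow> \<not> y b i))"
  shows "selects (fin_supp \<union> y ` J)"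
  unfolding selects_def
proof (intro allI impI)
  define X where "X = fin_supp \<union> y ` J"
  fix I :: "nat \<Rightarrow> (nat \<times> bool list list) set"
  assume "\<forall>n P. finite P \<and> P \<subseteq> fin_supp \<union> y ` J \<longrightarrow> (\<exists>c\<in>I n. P \<subseteq> clopen_of c)"
  then have I: "\<And>n P. finite P \<Longrightarrow> P \<subseteq> X \<Longrightarrow> \<exists>c\<in>I n. P \<subseteq> clopen_of c"
    by (auto simp: X_def)
  define good where "good \<phi> P \<longleftrightarrow> (\<exists>\<^sub>F n in sequentially. \<exists>c\<in>I n. to_nat c \<le> \<phi> n \<and> P \<subseteq> clopen_of c)"
    for \<phi> :: "nat \<Rightarrow> nat" and P
  have good_mono: "good \<psi> P" if "good \<phi> P" "le_star \<phi> \<psi>" for \<phi> \<psi> P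
    unfolding good_def
    by (rule frequently_rev_mp[OF that(1)[unfolded good_def]], rule eventually_mono[OF that(2)[unfolded le_star_iff]])
       (blast intro: order_trans)
  have cover: "\<exists>c. \<forall>n. c n \<in> I n \<and> fin_below n \<union> Q \<subseteq> clopen_of (c n)"
    if "finite Q" "Q \<subseteq> X" for Q
  proof (rule choice, rule allI)
    fix n
    have "fin_below n \<union> Q \<subseteq> X" using that(2) fin_below_subset[of n] unfolding X_def by blast
    then show "\<exists>c. c \<in> I n \<and> fin_below n \<union> Q \<subseteq> clopen_of c"
      using I[of "fin_below n \<union> Q" n] finite_fin_below[of n] that(1) by blast
  qed
  \<comment> \<open>One bound must serve all \<open>E\<close> and \<open>G\<close> of the given
    size. The fixed finite set \<open>Q\<close> varies in the induction, so that a point of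
    \<open>G\<close> can be moved into it.\<close>
  have claim: "\<exists>\<phi>. \<forall>E G. finite E \<and> E \<subseteq> fin_supp \<and> finite G \<and> G \<subseteq> J \<and> card G \<le> k \<longrightarrow>
      good \<phi> (E \<union> y ` G \<union> Q)" if "finite Q" "Q \<subseteq> X" for k Q
    using that
  proof (induction k arbitrary: Q)
    case (0 Q)
    obtain c where c: "\<And>n. c n \<in> I n" "\<And>n. fin_below n \<union> Q \<subseteq> clopen_of (c n)"
      using cover[OF 0] by blast
    have "good (\<lambda>n. to_nat (c n)) (E \<union> Q)" if E: "finite E" "E \<subseteq> fin_supp" for E
    proof -
      have "\<forall>\<^sub>F n in sequentially. E \<subseteq> fin_below n" by (rule eventually_fin_below[OF E])
      then have "\<forall>\<^sub>F n in sequentially. \<exists>c'\<in>I n. to_nat c' \<le> to_nat (c n) \<and> E \<union> Q \<subseteq> clopen_of c'"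
      proof (rule eventually_mono)
        fix n assume "E \<subseteq> fin_below n"
        then show "\<exists>c'\<in>I n. to_nat c' \<le> to_nat (c n) \<and> E \<union> Q \<subseteq> clopen_of c'"
          using c[of n] by (intro bexI[of _ "c n"]) auto
      qed
      then show ?thesis unfolding good_def by (intro eventually_frequently) auto
    qed
    then show ?case by (intro exI[of _ "\<lambda>n. to_nat (c n)"]) auto
  next
    case (Suc k Q)
    obtain c where c: "\<And>n. c n \<in> I n" "\<And>n. fin_below n \<union> Q \<subseteq> clopen_of (c n)"
      using cover[OF Suc.prems] by blast
    \<comment> \<open>\<open>h n\<close> is the prefix length that the code \<open>c n\<close>
      inspects.\<close>
    define h where "h n = fst (c n)" for n
    obtain S where S: "S \<subseteq> J" "small S"
      and gapS: "\<forall>F. finite F \<and> F \<subseteq> J - S \<longrightarrow>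
        (\<exists>\<^sub>F n in sequentially. \<forall>b\<in>F. \<forall>i. n \<le> i \<and> i < h n \<longrightarrow> \<not> y b i)"
      using gap[of h] by (elim exE conjE) (rule that)
    have "\<forall>a\<in>S. \<exists>\<phi>. \<forall>E G. finite E \<and> E \<subseteq> fin_supp \<and> finite G \<and> G \<subseteq> J \<and> card G \<le> k \<longrightarrow>
        good \<phi> (E \<union> y ` G \<union> insert (y a) Q)"
    proof
      fix a assume "a \<in> S"
      then show "\<exists>\<phi>. \<forall>E G. finite E \<and> E \<subseteq> fin_supp \<and> finite G \<and> G \<subseteq> J \<and> card G \<le> k \<longrightarrow>
          good \<phi> (E \<union> y ` G \<union> insert (y a) Q)"
        using S(1) Suc.prems by (intro Suc.IH) (auto simp: X_def)
    qed
    from bchoice[OF this] obtain \<phi> where \<phi>: "\<forall>a\<in>S. \<forall>E G. finite E \<and> E \<subseteq> fin_supp \<and> finite G \<and>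
        G \<subseteq> J \<and> card G \<le> k \<longrightarrow> good (\<phi> a) (E \<union> y ` G \<union> insert (y a) Q)" ..
    obtain \<psi> where \<psi>: "\<forall>a\<in>S. le_star (\<phi> a) \<psi>" by (rule smallE[OF S(2), of \<phi>])
    \<comment> \<open>\<open>\<psi>\<close> serves those \<open>G\<close> that meet
      \<open>S\<close>, the codes \<open>c n\<close> those that miss it.\<close>
    define \<rho> where "\<rho> n = max (\<psi> n) (to_nat (c n))" for n
    have "good \<rho> (E \<union> y ` G \<union> Q)"
      if E: "finite E" "E \<subseteq> fin_supp" and G: "finite G" "G \<subseteq> J" "card G \<le> Suc k" for E G
    proof (cases "G \<inter> S = {}")
      case True
      have "finite G \<and> G \<subseteq> J - S" using True G by auto
      then have "\<exists>\<^sub>F n in sequentially. \<forall>b\<in>G. \<forall>i. n \<le> i \<and> i < h n \<longrightarrow> \<not> y b i"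
        using gapS by simp
      then have "\<exists>\<^sub>F n in sequentially. (\<forall>b\<in>G. \<forall>i. n \<le> i \<and> i < h n \<longrightarrow> \<not> y b i) \<and> E \<subseteq> fin_below n"
        by (rule frequently_eventually_frequently[OF _ eventually_fin_below[OF E]])
      then show ?thesis unfolding good_def
      proof (rule frequently_mono[rotated], intro impI allI)
        fix n assume n: "(\<forall>b\<in>G. \<forall>i. n \<le> i \<and> i < h n \<longrightarrow> \<not> y b i) \<and> E \<subseteq> fin_below n"
        have "y b \<in> clopen_of (c n)" if "b \<in> G" for b
        proof -
          \<comment> \<open>The truncation of \<open>y b\<close> below \<open>n\<close>; by the gap
            it agrees with \<open>y b\<close> on the whole prefix of length
            \<open>h n\<close>.\<close>
          define z where "z i \<longleftrightarrow> y b i \<and> i < n" for i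
          have "z \<in> fin_below n" by (simp add: z_def fin_below_def)
          then have "z \<in> clopen_of (c n)" using c(2)[of n] by blast
          moreover have "pre (h n) z = pre (h n) (y b)"
            using n that unfolding pre_eq_iff z_def by (metis not_less)
          ultimately show ?thesis by (simp add: clopen_of_def h_def)
        qed
        then show "\<exists>c'\<in>I n. to_nat c' \<le> \<rho> n \<and> E \<union> y ` G \<union> Q \<subseteq> clopen_of c'"
          using c[of n] n by (intro bexI[of _ "c n"]) (auto simp: \<rho>_def)
      qed
    next
      case False
      then obtain a where a: "a \<in> G" "a \<in> S" by blast
      have "card (G - {a}) \<le> k" using a(1) G by simp
      then have "good (\<phi> a) (E \<union> y ` (G - {a}) \<union> insert (y a) Q)"
        using a E G by (intro \<phi>[rule_format]) auto
      moreover have "E \<union> y ` (G - {a}) \<union> insert (y a) Q = E \<union> y ` G \<union> Q" using a(1) by auto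
      moreover have "le_star (\<phi> a) \<rho>"
        by (rule le_star_le_trans[of _ \<psi>]) (use a \<psi> in \<open>auto simp: \<rho>_def\<close>)
      ultimately show ?thesis using good_mono by metis
    qed
    then show ?case by blast
  qed
  have "\<forall>k. \<exists>\<phi>. \<forall>E G. finite E \<and> E \<subseteq> fin_supp \<and> finite G \<and> G \<subseteq> J \<and> card G \<le> k \<longrightarrow>
      good \<phi> (E \<union> y ` G)"
    using claim[of "{}"] by simp
  from choice[OF this] obtain \<phi> where \<phi>: "\<forall>k E G. finite E \<and> E \<subseteq> fin_supp \<and> finite G \<and>
      G \<subseteq> J \<and> card G \<le> k \<longrightarrow> good (\<phi> k) (E \<union> y ` G)" ..
  obtain \<psi> where \<psi>: "\<And>k. le_star (\<phi> k) \<psi>" using countable_bounded by metis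
  have "good \<psi> P" if P: "finite P" "P \<subseteq> X" for P
  proof -
    have "P - fin_supp \<subseteq> y ` J" using P by (auto simp: X_def)
    then obtain G where G: "G \<subseteq> J" "finite G" "P - fin_supp = y ` G"
      using P(1) by (meson finite_Diff finite_subset_image)
    have "good (\<phi> (card G)) ((P \<inter> fin_supp) \<union> y ` G)"
      using G P by (intro \<phi>[rule_format]) auto
    also have "(P \<inter> fin_supp) \<union> y ` G = P" using G(3) by blast
    finally show ?thesis using good_mono \<psi> by blast
  qed
  then show "\<exists>\<phi>::nat \<Rightarrow> nat. \<forall>P. finite P \<and> P \<subseteq> fin_supp \<union> y ` J \<longrightarrow>
        (\<exists>\<^sub>F n in sequentially. \<exists>c\<in>I n. to_nat c \<le> \<phi> n \<and> P \<subseteq> clopen_of c)"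
    unfolding good_def X_def by blast
qed

subsection \<open>Sets made of alternate blocks\<close>

text \<open>The number \<open>j\<close> of the block from \<open>(g ^^ j) 0\<close> inclusive to
  \<open>(g ^^ Suc j) 0\<close> exclusive that contains \<open>i\<close>, when \<open>g\<close> lies
  above the identity.\<close>

definition block :: "(nat \<Rightarrow> nat) \<Rightarrow> nat \<Rightarrow> nat" where
  "block g i = (LEAST j. i < (g ^^ Suc j) 0)"

definition alt :: "bool \<Rightarrow> (nat \<Rightarrow> nat) \<Rightarrow> nat \<Rightarrow> bool" where
  "alt e g i \<longleftrightarrow> (odd (block g i) = e)"

lemma alt_False: "alt False g = (\<lambda>i. \<not> alt True g i)"
  by (simp add: alt_def fun_eq_iff)

context
  fixes g :: "nat \<Rightarrow> nat"
  assumes g: "strict_mono g" "\<And>n. n < g n"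
begin

lemma mono_marks: "i \<le> j \<Longrightarrow> (g ^^ i) 0 \<le> (g ^^ j) 0"
  by (rule lift_Suc_mono_le[of "\<lambda>j. (g ^^ j) 0"]) (use g(2) in \<open>auto intro: less_imp_le\<close>)

lemma le_marks: "j \<le> (g ^^ j) 0"
proof (induction j)
  case (Suc j)
  then show ?case using g(2)[of "(g ^^ j) 0"] by simp
qed simp

lemma block_upper: "i < g ((g ^^ block g i) 0)"
proof -
  have "i < (g ^^ Suc i) 0" using le_marks[of "Suc i"] by simp
  then have "i < (g ^^ Suc (block g i)) 0" unfolding block_def by (rule LeastI)
  then show ?thesis by simp
qed

lemma block_lower: "(g ^^ block g i) 0 \<le> i"
proof (cases "block g i")
  case (Suc j)
  then have "\<not> i < (g ^^ Suc j) 0" unfolding block_def by (intro not_less_Least) simp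
  then show ?thesis using Suc by simp
qed simp

lemma block_eq:
  assumes "(g ^^ j) 0 \<le> i" "i < g ((g ^^ j) 0)"
  shows "block g i = j"
proof (rule antisym)
  show "block g i \<le> j" unfolding block_def by (rule Least_le) (use assms in simp)
  show "j \<le> block g i"
  proof (rule ccontr)
    assume "\<not> j \<le> block g i"
    then have "(g ^^ Suc (block g i)) 0 \<le> (g ^^ j) 0" by (intro mono_marks) simp
    then show False using block_upper[of i] assms(1) by simp
  qed
qed

text \<open>The block following that of \<open>n\<close> starts at some \<open>q \<le> g n\<close>,
  and the one after it starts at \<open>g q \<le> g (g n)\<close>. One of these two has the parity
  that \<open>alt e g\<close> omits.\<close>

lemma alt_gap:
  obtains p where "n \<le> p" "p \<le> g (g n)" "\<And>i. p \<le> i \<Longrightarrow> i < g p \<Longrightarrow> \<not> alt e g i"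
proof -
  define j where "j = (if odd (block g n) = e then Suc (block g n) else Suc (Suc (block g n)))"
  define p where "p = (g ^^ j) 0"
  define q where "q = (g ^^ Suc (block g n)) 0"
  have q: "n < q" "q \<le> g n"
    using block_upper[of n] block_lower[of n] strict_mono_less_eq[OF g(1)] by (auto simp: q_def)
  have gq: "g q \<le> g (g n)" using q(2) strict_mono_less_eq[OF g(1)] by simp
  have "p = q \<or> p = g q" by (simp add: p_def q_def j_def)
  then have "n \<le> p" "p \<le> g (g n)" using q gq g(2)[of q] by auto
  moreover have "\<not> alt e g i" if "p \<le> i" "i < g p" for i
    using block_eq[of j i] that by (auto simp: p_def alt_def j_def split: if_splits)
  ultimately show ?thesis using that by blast
qed

text \<open>A gap of the opposite parity class consists of members of \<open>alt e g\<close>, and it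
  is nonempty because \<open>p < g p\<close>.\<close>

lemma alt_frequent: "\<exists>i\<ge>n. alt e g i"
proof -
  obtain p where "n \<le> p" "\<And>i. p \<le> i \<Longrightarrow> i < g p \<Longrightarrow> \<not> alt (\<not> e) g i"
    using alt_gap[of n "\<not> e"] by blast
  then have "\<not> alt (\<not> e) g p" using g(2) by blast
  then show ?thesis using \<open>n \<le> p\<close> by (auto simp: alt_def)
qed

lemma alt_not_fin_supp: "alt e g \<notin> fin_supp"
proof
  assume "alt e g \<in> fin_supp"
  then obtain m where "\<forall>i. alt e g i \<longrightarrow> i < m" using finite_nat_set_iff_bounded by auto
  then show False using alt_frequent[of m e] by (auto simp: not_less)
qed

end

section \<open>Counting changes of value\<close>

text \<open>"Few" means at most one change of value from \<open>n\<close> up to \<open>m\<close>.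
  For fixed \<open>n\<close> the complements are clopen, increase with \<open>m\<close>, and cover
  all sets that are neither finite nor cofinite.\<close>

definition few_switches :: "nat \<Rightarrow> nat \<Rightarrow> (nat \<Rightarrow> bool) set" where
  "few_switches n m = {x. \<not> (\<exists>u v w. n \<le> u \<and> u < v \<and> v < w \<and> w < m \<and> x u \<noteq> x v \<and> x v \<noteq> x w)}"

lemma few_switches_antimono: "m \<le> m' \<Longrightarrow> few_switches n m' \<subseteq> few_switches n m"
  by (clarsimp simp: few_switches_def) (meson less_le_trans)

lemma few_switches_pre:
  assumes "pre m x = pre m y" "x \<in> few_switches n m"
  shows "y \<in> few_switches n m"
proof (rule ccontr)
  assume "y \<notin> few_switches n m"
  then obtain u v w where uvw: "n \<le> u" "u < v" "v < w" "w < m" "y u \<noteq> y v" "y v \<noteq> y w"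
    unfolding few_switches_def by blast
  then have "x u = y u" "x v = y v" "x w = y w" using assms(1) by (simp_all add: pre_eq_iff)
  then show False using uvw assms(2) unfolding few_switches_def by blast
qed

text \<open>As \<open>n\<close> lies before the end of its block, monotonicity puts
  \<open>g n\<close> before the end of the next one. The interval from \<open>n\<close> up to
  \<open>g n\<close> thus meets at most two blocks.\<close>

lemma alt_few_switches:
  assumes g: "strict_mono g" "\<And>n. n < g n"
  shows "alt e g \<in> few_switches n (g n)"
proof -
  define j where "j = block g n"
  have "block g i = (if i < (g ^^ Suc j) 0 then j else Suc j)" if "n \<le> i" "i < g n" for i
  proof -
    have "(g ^^ j) 0 \<le> n" "n < (g ^^ Suc j) 0"
      using block_lower[OF g] block_upper[OF g, of n] by (auto simp: j_def)
    moreover from this(2) have "g n < g ((g ^^ Suc j) 0)" using strict_mono_less[OF g(1)] by blast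
    ultimately show ?thesis using that block_eq[OF g, of j i] block_eq[OF g, of "Suc j" i] by auto
  qed
  then show ?thesis unfolding few_switches_def alt_def by (auto split: if_splits)
qed

text \<open>Beyond \<open>n\<close> the values True, False, True occur in this order, and they
  witness two changes for all large \<open>m\<close>.\<close>

lemma eventually_not_few_switches:
  assumes "x \<notin> fin_supp" "(\<lambda>i. \<not> x i) \<notin> fin_supp"
  shows "\<forall>\<^sub>F m in sequentially. x \<notin> few_switches n m"
proof -
  have inf: "\<exists>i>k. x i = e" for k e
  proof (rule ccontr)
    assume "\<not> ?thesis"
    then have "{i. x i = e} \<subseteq> {..k}" by (auto simp: not_less)
    then have "finite {i. x i = e}" by (rule finite_subset) simp
    then show False using assms by (cases e) auto
  qed
  obtain u v w where "n < u" "x u" "u < v" "\<not> x v" "v < w" "x w"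
    using inf[of n True] inf[of _ False] inf[of _ True] by metis
  then have "n \<le> u \<and> u < v \<and> v < w \<and> w < Suc w \<and> x u \<noteq> x v \<and> x v \<noteq> x w" by simp
  then have "x \<notin> few_switches n (Suc w)" unfolding few_switches_def by blast
  then have "\<forall>m\<ge>Suc w. x \<notin> few_switches n m" using few_switches_antimono by blast
  then show ?thesis unfolding eventually_sequentially by blast
qed

section \<open>Common gaps along a scale\<close>

locale scale =
  fixes r :: "'i rel" and g :: "'i \<Rightarrow> nat \<Rightarrow> nat"
  assumes wo: "Well_order r"
    and small_under: "a \<in> Field r \<Longrightarrow> small (under r a)"
    and mono_g: "strict_mono (g a)"
    and less_g: "n < g a n"
    and le_star_g: "b \<in> underS r a \<Longrightarrow> le_star (g b ^^ 3) (g a)"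
    and dominating: "\<exists>a\<in>Field r. le_star h (g a)"
begin

definition common_gap :: "bool \<Rightarrow> (nat \<Rightarrow> nat) \<Rightarrow> 'i set \<Rightarrow> nat \<Rightarrow> bool" where
  "common_gap e h F n \<longleftrightarrow> (\<forall>b\<in>F. \<forall>i. n \<le> i \<and> i < h n \<longrightarrow> \<not> alt e (g b) i)"

text \<open>The bound on \<open>h n'\<close> is the induction invariant: three steps of
  \<open>g m\<close> are eventually below one step of \<open>g a\<close> for any later
  \<open>a\<close>, so the gap found for \<open>F\<close> fits into a single block of
  \<open>g a\<close>.\<close>

definition catches :: "bool \<Rightarrow> (nat \<Rightarrow> nat) \<Rightarrow> 'i set \<Rightarrow> 'i \<Rightarrow> bool" where
  "catches e h F m \<longleftrightarrow>
    (\<forall>\<^sub>F n in sequentially. \<exists>n'\<ge>n. h n' \<le> (g m ^^ 3) n \<and> common_gap e h F n')"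

lemma catches_empty:
  assumes "le_star h (g a)"
  shows "catches e h {} a"
  using assms unfolding catches_def le_star_iff
proof (elim eventually_mono)
  fix n assume "h n \<le> g a n"
  also have "\<dots> \<le> (g a ^^ 3) n"
    using less_g[of "g a n" a] less_g[of "g a (g a n)" a] by (simp add: numeral_3_eq_3)
  finally show "\<exists>n'\<ge>n. h n' \<le> (g a ^^ 3) n \<and> common_gap e h {} n'"
    by (auto simp: common_gap_def)
qed

text \<open>Two steps of \<open>g a\<close> lead from \<open>n\<close> to a start \<open>p\<close>
  of a block omitted by \<open>alt e (g a)\<close>. Applied at \<open>p\<close>, the assumption
  gives a gap for \<open>F\<close> that ends by \<open>(g b ^^ 3) p \<le> g a p\<close>, hence
  inside that block and within three steps of \<open>g a\<close> from \<open>n\<close>.\<close>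

lemma catches_insert:
  assumes "catches e h F b" "b \<in> underS r a"
  shows "catches e h (insert a F) a"
proof -
  have "\<forall>\<^sub>F n in sequentially. (\<exists>n'\<ge>n. h n' \<le> (g b ^^ 3) n \<and> common_gap e h F n') \<and>
      (g b ^^ 3) n \<le> g a n"
    using assms(1) le_star_g[OF assms(2)] unfolding catches_def le_star_iff
    by (rule eventually_conj)
  then obtain N where N: "\<And>n. n \<ge> N \<Longrightarrow> \<exists>n'\<ge>n. h n' \<le> g a n \<and> common_gap e h F n'"
    unfolding eventually_sequentially by (metis order_trans)
  have "\<exists>n'\<ge>n. h n' \<le> (g a ^^ 3) n \<and> common_gap e h (insert a F) n'" if "n \<ge> N" for n
  proof -
    obtain p where p: "n \<le> p" "p \<le> g a (g a n)" "\<And>i. p \<le> i \<Longrightarrow> i < g a p \<Longrightarrow> \<not> alt e (g a) i"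
      using alt_gap[OF mono_g less_g, of n a e] by blast
    have "N \<le> p" using that p(1) by simp
    then obtain n' where n': "p \<le> n'" "h n' \<le> g a p" "common_gap e h F n'" using N by blast
    have "g a p \<le> (g a ^^ 3) n"
      using p(2) strict_mono_less_eq[OF mono_g] by (simp add: numeral_3_eq_3)
    moreover have "\<not> alt e (g a) i" if "n' \<le> i" "i < h n'" for i
      using p(3)[of i] that n' by simp
    then have "common_gap e h (insert a F) n'" using n'(3) by (auto simp: common_gap_def)
    ultimately show ?thesis using n' p(1) by (meson order_trans)
  qed
  then show ?thesis unfolding catches_def eventually_sequentially by blast
qed

lemma
  shows refl: "a \<in> Field r \<Longrightarrow> (a, a) \<in> r"
    and trans: "(a, b) \<in> r \<Longrightarrow> (b, c) \<in> r \<Longrightarrow> (a, c) \<in> r"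
    and total: "a \<in> Field r \<Longrightarrow> b \<in> Field r \<Longrightarrow> a \<noteq> b \<Longrightarrow> (a, b) \<in> r \<or> (b, a) \<in> r"
  using wo unfolding well_order_on_def linear_order_on_def partial_order_on_def preorder_on_def
  by (auto simp: refl_on_def total_on_def dest: transD)

lemma finite_has_top:
  assumes "finite F" "F \<noteq> {}" "F \<subseteq> Field r"
  shows "\<exists>m\<in>F. \<forall>x\<in>F. (x, m) \<in> r"
  using assms
proof (induction F rule: finite_ne_induct)
  case (singleton x)
  then show ?case using refl by blast
next
  case (insert x F)
  then obtain m where m: "m \<in> F" "\<forall>y\<in>F. (y, m) \<in> r" by blast
  have "x \<in> Field r" "m \<in> Field r" using insert.prems m(1) by auto
  then consider "(x, m) \<in> r" | "(m, x) \<in> r" using total refl by blast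
  then show ?case
  proof cases
    case 1
    then show ?thesis using m by blast
  next
    case 2
    have "(y, x) \<in> r" if "y \<in> F" for y using trans[of y m x] m(2) 2 that by blast
    then show ?thesis using refl[OF \<open>x \<in> Field r\<close>] by blast
  qed
qed

text \<open>The members of \<open>F\<close> are added in increasing order, starting from
  \<open>a\<close>, which catches the empty set because \<open>g a\<close> dominates
  \<open>h\<close>.\<close>

lemma ex_catches:
  assumes "le_star h (g a)" "finite F" "\<And>b. b \<in> F \<Longrightarrow> a \<in> underS r b"
  shows "\<exists>m\<in>insert a F. catches e h F m"
  using assms(2,3)
proof (induction "card F" arbitrary: F)
  case 0
  then show ?case using catches_empty[OF assms(1)] by auto
next
  case (Suc k)
  have "F \<subseteq> Field r" using Suc.prems(2) by (force simp: underS_def Field_def)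
  moreover have "F \<noteq> {}" using Suc.hyps(2) by auto
  ultimately obtain m where m: "m \<in> F" "\<forall>x\<in>F. (x, m) \<in> r"
    using finite_has_top[OF Suc.prems(1)] by blast
  have "\<exists>b\<in>insert a (F - {m}). catches e h (F - {m}) b"
    using Suc.hyps(2) Suc.prems m(1) by (intro Suc.hyps(1)) auto
  then obtain b where b: "b \<in> insert a (F - {m})" "catches e h (F - {m}) b" by blast
  \<comment> \<open>The index that catches the rest lies strictly below the top \<open>m\<close>, as
    it is \<open>a\<close> or another member of \<open>F\<close>.\<close>
  have "b \<in> underS r m" using b(1) m Suc.prems(2)[of m] by (auto simp: underS_def)
  then have "catches e h (insert m (F - {m})) m" by (rule catches_insert[OF b(2)])
  then show ?case using m(1) by (auto simp: insert_absorb)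
qed

lemma frequently_common_gap:
  assumes "catches e h F m"
  shows "\<exists>\<^sub>F n in sequentially. common_gap e h F n"
  unfolding frequently_sequentially
proof
  fix N
  obtain M where M: "\<And>n. n \<ge> M \<Longrightarrow> \<exists>n'\<ge>n. common_gap e h F n'"
    using assms unfolding catches_def eventually_sequentially by blast
  show "\<exists>n\<ge>N. common_gap e h F n" using M[of "max M N"] by auto
qed

definition points :: "bool \<Rightarrow> (nat \<Rightarrow> bool) set" where
  "points e = fin_supp \<union> (\<lambda>a. alt e (g a)) ` Field r"

text \<open>Given \<open>h\<close>, pick \<open>a\<close> with \<open>g a\<close> dominating
  \<open>h\<close>. The indices up to \<open>a\<close> form the small exceptional set, and finitely
  many later ones have common gaps by \<open>ex_catches\<close>.\<close>

lemma selects_points: "selects (points e)"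
  unfolding points_def
proof (rule selects_gap)
  fix h :: "nat \<Rightarrow> nat"
  obtain a where a: "a \<in> Field r" "le_star h (g a)" using dominating by blast
  have "\<exists>\<^sub>F n in sequentially. common_gap e h F n" if F: "finite F" "F \<subseteq> Field r - under r a" for F
  proof -
    have "a \<in> underS r b" if "b \<in> F" for b
      using that F(2) a(1) total[of a b] refl[of a] by (auto simp: under_def underS_def)
    then show ?thesis using ex_catches[OF a(2) F(1)] frequently_common_gap by blast
  qed
  moreover have "under r a \<subseteq> Field r" by (auto simp: under_def Field_def)
  ultimately show "\<exists>S\<subseteq>Field r. small S \<and> (\<forall>F. finite F \<and> F \<subseteq> Field r - S \<longrightarrow>
        (\<exists>\<^sub>F n in sequentially. \<forall>b\<in>F. \<forall>i. n \<le> i \<and> i < h n \<longrightarrow> \<not> alt e (g b) i))"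
    using small_under[OF a(1)] unfolding common_gap_def by (intro exI[of _ "under r a"]) blast
qed

lemma M_separable_points: "M_separable (Cp (subtopology cantor_space (points e)))"
  by (rule selects_imp_M_separable[OF selects_points])

section \<open>Failure of M-separability for the product\<close>

text \<open>Translates a cover into functions: the complements of \<open>few_switches n m\<close>,
  increasing in \<open>m\<close>, cover the complementary pairs of points, and both values may
  differ from 1 only at pairs inside one member of this cover.\<close>

definition diag_dense :: "nat \<Rightarrow> (((nat \<Rightarrow> bool) \<Rightarrow> real) \<times> ((nat \<Rightarrow> bool) \<Rightarrow> real)) set" where
  "diag_dense n = {(f0, f1). f0 \<in> topspace (Cp (subtopology cantor_space (points True))) \<and>
      f1 \<in> topspace (Cp (subtopology cantor_space (points False))) \<and>
      (\<exists>m. \<forall>a\<in>Field r. alt True (g a) \<in> few_switches n m \<longrightarrow>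
         f0 (alt True (g a)) = 1 \<or> f1 (alt False (g a)) = 1)}"

lemma alt_in_points: "a \<in> Field r \<Longrightarrow> alt e (g a) \<in> points e"
  by (simp add: points_def)

text \<open>The default value 1 away from the prescribed prefixes is what brings the interpolating
  functions into \<open>diag_dense\<close>.\<close>

lemma prefix_interpolation:
  assumes "inj_on (pre N) P"
  obtains h :: "bool list \<Rightarrow> real"
  where "\<forall>p\<in>P. h (pre N p) = f p" "\<forall>x. pre N x \<notin> pre N ` P \<longrightarrow> h (pre N x) = 1"
  by (rule that[of "\<lambda>s. if s \<in> pre N ` P then f (inv_into P (pre N) s) else 1"])
     (use assms in auto)

text \<open>\<open>p\<close> and its complement are not both finite, so one of them comes from the
  scale; either way \<open>p\<close> is some \<open>alt True (g a)\<close>, which is infinite with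
  infinite complement.\<close>

lemma complementary_points:
  assumes "p \<in> points True" "(\<lambda>i. \<not> p i) \<in> points False"
  shows "p \<notin> fin_supp" "(\<lambda>i. \<not> p i) \<notin> fin_supp"
proof -
  have *: "\<not> (x \<in> fin_supp \<and> (\<lambda>i. \<not> x i) \<in> fin_supp)" for x :: "nat \<Rightarrow> bool"
  proof
    assume "x \<in> fin_supp \<and> (\<lambda>i. \<not> x i) \<in> fin_supp"
    then have "finite ({i. x i} \<union> {i. \<not> x i})" by simp
    moreover have "{i. x i} \<union> {i. \<not> x i} = UNIV" by auto
    ultimately show False by simp
  qed
  have nf: "alt e (g a) \<notin> fin_supp" for e a by (rule alt_not_fin_supp[OF mono_g less_g])
  have 1: "q \<notin> fin_supp" "(\<lambda>i. \<not> q i) \<notin> fin_supp"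
    if "q = alt True (g a)" for q a using nf[of True a] nf[of False a] that by (simp_all add: alt_False)
  have c: "p = alt True (g a)" if "(\<lambda>i. \<not> p i) = alt False (g a)" for a
    using that by (auto simp: alt_False fun_eq_iff)
  have "\<exists>a. p = alt True (g a)"
    using assms *[of p] c unfolding points_def by blast
  then show "p \<notin> fin_supp" "(\<lambda>i. \<not> p i) \<notin> fin_supp" using 1 by blast+
qed

text \<open>The values on the finite sets \<open>P0\<close> and \<open>P1\<close> are interpolated
  by functions of a prefix of length \<open>N\<close>, equal to 1 at all other prefixes. If
  \<open>N\<close> is large, both differ from 1 only near complementary pairs from \<open>P0\<close>
  and \<open>P1\<close>, and these already switch twice between \<open>n\<close> and
  \<open>N\<close>; so \<open>N\<close> is the required \<open>m\<close>.\<close>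

lemma dense_diag_dense:
  "dense_in (prod_topology (Cp (subtopology cantor_space (points True)))
      (Cp (subtopology cantor_space (points False)))) (diag_dense n)"
  (is "dense_in (prod_topology (Cp ?T0) (Cp ?T1)) _")
  unfolding dense_in_iff
proof (intro conjI allI impI)
  show "diag_dense n \<subseteq> topspace (prod_topology (Cp ?T0) (Cp ?T1))"
    by (auto simp: diag_dense_def)
next
  fix z U assume zU: "openin (prod_topology (Cp ?T0) (Cp ?T1)) U \<and> z \<in> U"
  obtain g0 g1 where z: "z = (g0, g1)" by fastforce
  obtain U0 U1 where U: "openin (Cp ?T0) U0" "openin (Cp ?T1) U1" "g0 \<in> U0" "g1 \<in> U1" "U0 \<times> U1 \<subseteq> U"
    using zU z unfolding openin_prod_topology_alt by blast
  obtain P0 \<epsilon>0 where P0: "finite P0" "P0 \<subseteq> topspace ?T0" "\<epsilon>0 > 0"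
    "\<And>f. f \<in> topspace (Cp ?T0) \<Longrightarrow> \<forall>p\<in>P0. \<bar>f p - g0 p\<bar> < \<epsilon>0 \<Longrightarrow> f \<in> U0"
    by (rule Cp_nhd[OF U(1,3)]) (rule that)
  obtain P1 \<epsilon>1 where P1: "finite P1" "P1 \<subseteq> topspace ?T1" "\<epsilon>1 > 0"
    "\<And>f. f \<in> topspace (Cp ?T1) \<Longrightarrow> \<forall>p\<in>P1. \<bar>f p - g1 p\<bar> < \<epsilon>1 \<Longrightarrow> f \<in> U1"
    by (rule Cp_nhd[OF U(2,4)]) (rule that)
  \<comment> \<open>Collecting \<open>P0\<close> with the complements of \<open>P1\<close> lets
    injectivity of \<open>pre N\<close> turn agreement of prefixes into genuine
    complementarity.\<close>
  define Q where "Q = P0 \<union> (\<lambda>q i. \<not> q i) ` P1"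
  \<comment> \<open>By \<open>complementary_points\<close>, \<open>R\<close> contains each point of
    \<open>P0\<close> whose complement lies in \<open>P1\<close>.\<close>
  define R where "R = {p \<in> P0. p \<notin> fin_supp \<and> (\<lambda>i. \<not> p i) \<notin> fin_supp}"
  have "\<forall>\<^sub>F N in sequentially. \<forall>p\<in>R. p \<notin> few_switches n N"
    using P0(1) eventually_not_few_switches
    by (intro eventually_ball_finite) (auto simp: R_def)
  moreover have "\<forall>\<^sub>F N in sequentially. inj_on (pre N) Q"
    using P0(1) P1(1) by (intro eventually_inj_on_pre) (simp add: Q_def)
  ultimately have "\<forall>\<^sub>F N in sequentially. (\<forall>p\<in>R. p \<notin> few_switches n N) \<and> inj_on (pre N) Q"
    by (rule eventually_conj)
  then obtain N where N: "\<forall>p\<in>R. p \<notin> few_switches n N" "inj_on (pre N) Q"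
    unfolding eventually_sequentially by blast
  have pre_not: "pre N (\<lambda>i. \<not> x i) = pre N (\<lambda>i. \<not> y i) \<longleftrightarrow> pre N x = pre N y" for x y
    by (auto simp: pre_eq_iff)
  have inj0: "inj_on (pre N) P0" using N(2) by (rule inj_on_subset) (simp add: Q_def)
  have inj1: "inj_on (pre N) P1"
  proof (rule inj_onI)
    fix x y assume xy: "x \<in> P1" "y \<in> P1" "pre N x = pre N y"
    then have "(\<lambda>i. \<not> x i) = (\<lambda>i. \<not> y i)"
      using pre_not by (intro inj_onD[OF N(2)]) (auto simp: Q_def)
    then show "x = y" by (auto simp: fun_eq_iff)
  qed
  obtain h0 where h0: "\<forall>p\<in>P0. h0 (pre N p) = g0 p" "\<forall>x. pre N x \<notin> pre N ` P0 \<longrightarrow> h0 (pre N x) = 1"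
    by (rule prefix_interpolation[OF inj0])
  obtain h1 where h1: "\<forall>p\<in>P1. h1 (pre N p) = g1 p" "\<forall>x. pre N x \<notin> pre N ` P1 \<longrightarrow> h1 (pre N x) = 1"
    by (rule prefix_interpolation[OF inj1])
  define f0 where "f0 = restrict (\<lambda>x. h0 (pre N x)) (points True)"
  define f1 where "f1 = restrict (\<lambda>x. h1 (pre N x)) (points False)"
  have fC: "f0 \<in> topspace (Cp ?T0)" "f1 \<in> topspace (Cp ?T1)"
    unfolding f0_def f1_def by (rule prefix_function_in_Cp)+
  have sub: "P0 \<subseteq> points True" "P1 \<subseteq> points False" using P0(2) P1(2) by simp_all
  have "f0 \<in> U0"
  proof (rule P0(4)[OF fC(1)])
    show "\<forall>p\<in>P0. \<bar>f0 p - g0 p\<bar> < \<epsilon>0" using h0(1) sub(1) P0(3) by (auto simp: f0_def)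
  qed
  moreover have "f1 \<in> U1"
  proof (rule P1(4)[OF fC(2)])
    show "\<forall>p\<in>P1. \<bar>f1 p - g1 p\<bar> < \<epsilon>1" using h1(1) sub(2) P1(3) by (auto simp: f1_def)
  qed
  ultimately have "(f0, f1) \<in> U" using U(5) by blast
  moreover have "f0 (alt True (g a)) = 1 \<or> f1 (alt False (g a)) = 1"
    if a: "a \<in> Field r" "alt True (g a) \<in> few_switches n N" for a
  proof (rule ccontr)
    assume "\<not> ?thesis"
    then have "h0 (pre N (alt True (g a))) \<noteq> 1" "h1 (pre N (alt False (g a))) \<noteq> 1"
      using alt_in_points[OF a(1)] by (auto simp: f0_def f1_def)
    then obtain p q where p: "p \<in> P0" "pre N (alt True (g a)) = pre N p"
      and q: "q \<in> P1" "pre N (alt False (g a)) = pre N q"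
      using h0(2) h1(2) by blast
    have "pre N p = pre N (\<lambda>i. \<not> q i)"
      using p(2) q(2) by (auto simp: alt_False pre_eq_iff)
    then have pq: "p = (\<lambda>i. \<not> q i)"
      by (rule inj_onD[OF N(2)]) (use p q in \<open>auto simp: Q_def\<close>)
    then have "p \<in> points True" "(\<lambda>i. \<not> p i) \<in> points False" using p(1) q(1) sub by auto
    then have "p \<in> R" using complementary_points p(1) unfolding R_def by blast
    then have "p \<notin> few_switches n N" using N(1) by blast
    then show False using few_switches_pre[OF p(2) a(2)] by blast
  qed
  then have "(f0, f1) \<in> diag_dense n" using fC unfolding diag_dense_def by blast
  ultimately show "\<exists>d\<in>diag_dense n. d \<in> U" by blast
qed

text \<open>Finite choices from all \<open>diag_dense n\<close> yield a function \<open>M\<close>,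
  dominated by some \<open>g a\<close>. At the pair given by \<open>a\<close>, each function pair
  chosen late has a coordinate with value 1, so a neighbourhood of small values misses it. The
  finitely many early choices are avoided separately.\<close>

lemma not_M_separable_prod:
  "\<not> M_separable (prod_topology (Cp (subtopology cantor_space (points True)))
      (Cp (subtopology cantor_space (points False))))"
  (is "\<not> M_separable (prod_topology (Cp ?T0) (Cp ?T1))")
proof
  assume M_sep: "M_separable (prod_topology (Cp ?T0) (Cp ?T1))"
  have "\<exists>F. (\<forall>n. finite (F n) \<and> F n \<subseteq> diag_dense n) \<and>
      dense_in (prod_topology (Cp ?T0) (Cp ?T1)) (\<Union>n. F n)"
    using M_sep[unfolded M_separable_def, THEN spec[of _ diag_dense]] dense_diag_dense by (rule mp[OF _ allI])
  then obtain F where F: "\<And>n. finite (F n)" "\<And>n. F n \<subseteq> diag_dense n"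
    and dense: "dense_in (prod_topology (Cp ?T0) (Cp ?T1)) (\<Union>n. F n)"
    by (elim exE conjE) (rule that, simp_all)
  define bad where "bad f m n \<longleftrightarrow> (\<forall>a\<in>Field r. alt True (g a) \<in> few_switches n m \<longrightarrow>
         fst f (alt True (g a)) = 1 \<or> snd f (alt False (g a)) = 1)"
    for f :: "((nat \<Rightarrow> bool) \<Rightarrow> real) \<times> ((nat \<Rightarrow> bool) \<Rightarrow> real)" and m n
  \<comment> \<open>Since \<open>few_switches n m\<close> shrinks as \<open>m\<close> grows, the
    maximum of the finitely many witnesses serves all of \<open>F n\<close>.\<close>
  have "\<exists>M. \<forall>f\<in>F n. bad f M n" for n
  proof -
    have "\<forall>f\<in>F n. \<exists>m. bad f m n"
      using F(2)[of n] unfolding diag_dense_def bad_def by fastforce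
    from bchoice[OF this] obtain m where m: "\<forall>f\<in>F n. bad f (m f) n" ..
    have "bad f (Max (m ` F n)) n" if "f \<in> F n" for f
    proof -
      have "few_switches n (Max (m ` F n)) \<subseteq> few_switches n (m f)"
        using F(1) that by (intro few_switches_antimono Max_ge) auto
      then show ?thesis using m that unfolding bad_def by blast
    qed
    then show ?thesis by blast
  qed
  then obtain M where M: "\<And>n f. f \<in> F n \<Longrightarrow> bad f (M n) n" by metis
  obtain a where a: "a \<in> Field r" "le_star M (g a)" using dominating by blast
  then obtain N where N: "\<And>n. n \<ge> N \<Longrightarrow> M n \<le> g a n"
    unfolding le_star_iff eventually_sequentially by blast
  define x0 x1 where "x0 = alt True (g a)" and "x1 = alt False (g a)"
  have x: "x0 \<in> points True" "x1 \<in> points False"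
    using alt_in_points[OF a(1)] by (simp_all add: x0_def x1_def)
  have late: "fst f x0 = 1 \<or> snd f x1 = 1" if "f \<in> F n" "n \<ge> N" for f n
  proof -
    have "alt True (g a) \<in> few_switches n (M n)"
      using alt_few_switches[OF mono_g less_g] few_switches_antimono[OF N[OF that(2)]] by blast
    then show ?thesis using M[OF that(1)] a(1) unfolding bad_def x0_def x1_def by blast
  qed
  \<comment> \<open>The values at \<open>x0\<close> of the finitely many early choices, about which
    \<open>late\<close> says nothing; removing them from an interval leaves the nonempty open set
    \<open>V\<close>.\<close>
  define E where "E = (\<lambda>f. fst f x0) ` (\<Union>n<N. F n)"
  have "finite E" using F(1) by (simp add: E_def)
  define V where "V = {-1/2<..<1/2::real} - E"
  have "open V" unfolding V_def using \<open>finite E\<close> by (intro open_Diff finite_imp_closed) auto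
  have "infinite V" unfolding V_def using \<open>finite E\<close> by (simp add: Diff_infinite_finite)
  then obtain t where t: "t \<in> V" using infinite_imp_nonempty by blast
  define W where "W = {f \<in> topspace (Cp ?T0). f x0 \<in> V} \<times> {f \<in> topspace (Cp ?T1). f x1 \<in> {-1/2<..<1/2::real}}"
  have "openin (prod_topology (Cp ?T0) (Cp ?T1)) W"
    unfolding W_def openin_prod_Times_iff using x \<open>open V\<close> by (intro disjI2 conjI openin_Cp_point) auto
  moreover have "(restrict (\<lambda>_. t) (points True), restrict (\<lambda>_. 0) (points False)) \<in> W"
    using t x const_in_Cp by (auto simp: W_def)
  ultimately obtain f where f: "f \<in> (\<Union>n. F n)" "f \<in> W"
    using dense unfolding dense_in_iff by blast
  then obtain n where n: "f \<in> F n" by blast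
  show False
  proof (cases "n \<ge> N")
    case True
    then show ?thesis using late[OF n] f(2) by (auto simp: W_def V_def)
  next
    case False
    then have "fst f x0 \<in> E" using n unfolding E_def by (intro imageI UN_I[of n]) auto
    then show ?thesis using f(2) by (auto simp: W_def V_def)
  qed
qed

end

theorem theorem2:
  assumes "b_eq_d"
  shows "\<exists>X0 X1 :: (nat \<Rightarrow> bool) set.
           X0 \<subseteq> topspace cantor_space \<and> X1 \<subseteq> topspace cantor_space \<and>
           M_separable (Cp (subtopology cantor_space X0)) \<and>
           M_separable (Cp (subtopology cantor_space X1)) \<and>
           \<not> M_separable (prod_topology (Cp (subtopology cantor_space X0))
                                         (Cp (subtopology cantor_space X1)))"
proof -
  obtain r :: "(nat \<Rightarrow> nat) rel" and g where "scale r g"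
    by (rule scale_exists[OF assms]) (rule that, unfold_locales)
  then interpret scale r g .
  show ?thesis
    using M_separable_points not_M_separable_prod
    by (intro exI[of _ "points True"] exI[of _ "points False"]) simp
qed

end
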